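(* Let $\omega_1,\omega_2,\omega_3$ be three pairwise distinct circles in the hyperbolic plane. Let $P_1$ be the center of a homothety with positive ratio taking $\omega_2$ to $\omega_3$, and define $P_2$ (for the pair $\omega_1,\omega_3$) and $P_3$ (for the pair $\omega_1,\omega_2$) similarly; assume that these three centers exist. Then the points $P_1,P_2,P_3$ are collinear. The conclusion is still valid if exactly two of the three homotheties are replaced by homotheties with negative ratio.
   Context: The pseudolength $d_E(A,B)$ of a hyperbolic segment $AB$ is the Euclidean length of the segment $AB$ after a hyperbolic motion placing $A$ at the center of the Poincaré disk of radius $1$ (equivalently, $d_E(A,B)=\tanh(\rho/2)$ where $\rho$ is the hyperbolic distance in curvature $-1$). A homothety with center $A$ and ratio $k\neq 0$ takes a point $P$ to the point $P'$ on the line $AP$ such that $d_E(A,P')=|k|\, d_E(A,P)$, with $P'$ on the ray $AP$ if $k>0$ and on the opposite ray if $k<0$ (for $|k|>1$ it is only defined for $P$ with $|k|\,d_E(A,P)<1$). Three points are collinear if they lie on a common hyperbolic straight line. *)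

theory Defs
  imports "HOL-Complex_Analysis.Riemann_Mapping"
begin

definition pdisk :: "complex set" where
  "pdisk = ball 0 1"

text \<open>The hyperbolic distance of the Poincare disk model, normalized to curvature -1.\<close>
definition hdist :: "complex \<Rightarrow> complex \<Rightarrow> real" where
  "hdist A B = arcosh (1 + 2 * (cmod (A - B))\<^sup>2 / ((1 - (cmod A)\<^sup>2) * (1 - (cmod B)\<^sup>2)))"

text \<open>
  \<^term>\<open>Moebius_function 0 A\<close> is a hyperbolic motion that places \<^term>\<open>A\<close> at the center of
  the disk. By \<open>pseudolength_motion\<close> below, every other such motion gives the same
  pseudolength.
\<close>
definition pseudolength :: "complex \<Rightarrow> complex \<Rightarrow> real" where
  "pseudolength A B = cmod (Moebius_function 0 A B)"

definition is_hcircle :: "complex set \<Rightarrow> bool" where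
  "is_hcircle \<omega> \<longleftrightarrow> (\<exists>c\<in>pdisk. \<exists>r>0. \<omega> = {z \<in> pdisk. hdist c z = r})"

text \<open>
  The lines are the diameters and the arcs of Euclidean circles orthogonal to the unit circle;
  orthogonality of \<^term>\<open>sphere c r\<close> is \<^term>\<open>(cmod c)\<^sup>2 = 1 + r\<^sup>2\<close>.
  Here \<^const>\<open>span\<close> is the real span.
\<close>
definition is_hline :: "complex set \<Rightarrow> bool" where
  "is_hline L \<longleftrightarrow>
     (\<exists>u. u \<noteq> 0 \<and> L = pdisk \<inter> span {u}) \<or>
     (\<exists>c r. r > 0 \<and> (cmod c)\<^sup>2 = 1 + r\<^sup>2 \<and> L = pdisk \<inter> sphere c r)"

definition hcollinear :: "complex \<Rightarrow> complex \<Rightarrow> complex \<Rightarrow> bool" where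
  "hcollinear A B C \<longleftrightarrow> (\<exists>L. is_hline L \<and> A \<in> L \<and> B \<in> L \<and> C \<in> L)"

text \<open>\<open>hbetween A B C\<close>: the point \<^term>\<open>B\<close> lies on the closed segment from \<^term>\<open>A\<close> to \<^term>\<open>C\<close>.\<close>
definition hbetween :: "complex \<Rightarrow> complex \<Rightarrow> complex \<Rightarrow> bool" where
  "hbetween A B C \<longleftrightarrow> hdist A B + hdist B C = hdist A C"

definition hray :: "complex \<Rightarrow> complex \<Rightarrow> complex set" where
  "hray A P = {X \<in> pdisk. hbetween A X P \<or> hbetween A P X}"

definition opposite_hray :: "complex \<Rightarrow> complex \<Rightarrow> complex set" where
  "opposite_hray A P = {X \<in> pdisk. hbetween P A X}"

text \<open>
  \<open>homothetic A k P P'\<close>: the homothety with center \<^term>\<open>A\<close> and ratio \<^term>\<open>k\<close> is defined at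
  \<^term>\<open>P\<close> and takes it to \<^term>\<open>P'\<close>. For \<^term>\<open>P = A\<close> both rays degenerate to the whole
  disk, and the length condition alone gives \<^term>\<open>P' = A\<close>.
\<close>
definition homothetic :: "complex \<Rightarrow> real \<Rightarrow> complex \<Rightarrow> complex \<Rightarrow> bool" where
  "homothetic A k P P' \<longleftrightarrow>
     k \<noteq> 0 \<and> pseudolength A P' = \<bar>k\<bar> * pseudolength A P \<and>
     P' \<in> (if k > 0 then hray A P else opposite_hray A P)"

definition homothety_takes :: "complex \<Rightarrow> real \<Rightarrow> complex set \<Rightarrow> complex set \<Rightarrow> bool" where
  "homothety_takes A k S T \<longleftrightarrow>
     A \<in> pdisk \<and> k \<noteq> 0 \<and>
     (\<forall>P\<in>S. \<bar>k\<bar> * pseudolength A P < 1) \<and>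
     T = {P'. \<exists>P\<in>S. homothetic A k P P'}"

lemma pdisk_iff: "z \<in> pdisk \<longleftrightarrow> cmod z < 1"
  by (simp add: pdisk_def)

lemma pdisk_sq: "z \<in> pdisk \<Longrightarrow> (cmod z)\<^sup>2 < 1"
  by (simp add: pdisk_iff power_less_one_iff abs_square_less_1)

lemma denominator_nz:
  assumes "A \<in> pdisk" "B \<in> pdisk"
  shows "1 - cnj A * B \<noteq> 0"
proof
  assume "1 - cnj A * B = 0"
  then have "cmod (cnj A * B) = 1"
    by (metis norm_one right_minus_eq)
  moreover have "cmod A * cmod B < 1 * 1"
    using assms by (intro mult_strict_mono') (auto simp: pdisk_iff)
  ultimately show False
    by (simp add: norm_mult)
qed

lemma denominator_sq:
  "(cmod (1 - cnj A * B))\<^sup>2 = (cmod (A - B))\<^sup>2 + (1 - (cmod A)\<^sup>2) * (1 - (cmod B)\<^sup>2)"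
  unfolding cmod_power2 by (simp add: algebra_simps power2_eq_square)

lemma pseudolength_nonneg: "pseudolength A B \<ge> 0"
  by (simp add: pseudolength_def)

lemma pseudolength_less_1:
  "A \<in> pdisk \<Longrightarrow> B \<in> pdisk \<Longrightarrow> pseudolength A B < 1"
  by (simp add: pseudolength_def pdisk_iff Moebius_function_norm_lt_1)

lemma hdist_nonneg:
  assumes "A \<in> pdisk" "B \<in> pdisk"
  shows "hdist A B \<ge> 0"
  unfolding hdist_def
  using pdisk_sq[OF assms(1)] pdisk_sq[OF assms(2)]
  by (intro arcosh_nonneg_real) simp

lemma cosh_hdist:
  assumes "A \<in> pdisk" "B \<in> pdisk"
  shows "cosh (hdist A B) =
    1 + 2 * (cmod (A - B))\<^sup>2 / ((1 - (cmod A)\<^sup>2) * (1 - (cmod B)\<^sup>2))"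
  unfolding hdist_def
  using pdisk_sq[OF assms(1)] pdisk_sq[OF assms(2)]
  by (intro cosh_arcosh_real) simp

lemma pseudolength_eq_tanh:
  assumes A: "A \<in> pdisk" and B: "B \<in> pdisk"
  shows "pseudolength A B = tanh (hdist A B / 2)"
proof -
  define q where "q = (1 - (cmod A)\<^sup>2) * (1 - (cmod B)\<^sup>2)"
  define n where "n = (cmod (A - B))\<^sup>2"
  define h where "h = hdist A B / 2"
  have q: "q > 0"
    using pdisk_sq[OF A] pdisk_sq[OF B] by (simp add: q_def)
  have n: "n \<ge> 0" by (simp add: n_def)
  have c: "cosh (2 * h) = 1 + 2 * n / q"
    using cosh_hdist[OF A B] by (simp add: h_def q_def n_def)
  have c2: "(cosh h)\<^sup>2 = 1 + n / q"
    using c cosh_double_cosh[of h] by simp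
  have s2: "(sinh h)\<^sup>2 = n / q"
    using c2 by (simp add: cosh_square_eq)
  have "(tanh h)\<^sup>2 = n / (n + q)"
    using q n by (simp add: tanh_def power_divide c2 s2 field_simps)
  also have "n / (n + q) = (pseudolength A B)\<^sup>2"
    using denominator_sq[of A B]
    by (simp add: pseudolength_def Moebius_function_simple norm_divide power_divide
        n_def q_def norm_minus_commute)
  finally have "(tanh h)\<^sup>2 = (pseudolength A B)\<^sup>2" .
  moreover have "tanh h \<ge> 0"
    using hdist_nonneg[OF A B] by (simp add: h_def)
  ultimately show ?thesis
    using pseudolength_nonneg[of A B] by (simp add: h_def)
qed

lemma hdist_eq_iff:
  assumes "A \<in> pdisk" "B \<in> pdisk" "C \<in> pdisk" "D \<in> pdisk"
  shows "hdist A B = hdist C D \<longleftrightarrow> pseudolength A B = pseudolength C D"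
  using assms by (simp add: pseudolength_eq_tanh)

lemma pseudolength_motion:
  assumes "\<And>z. z \<in> pdisk \<Longrightarrow> f z \<in> pdisk"
    and "\<And>z w. z \<in> pdisk \<Longrightarrow> w \<in> pdisk \<Longrightarrow> hdist (f z) (f w) = hdist z w"
    and "A \<in> pdisk" "B \<in> pdisk" "f A = 0"
  shows "cmod (f B) = pseudolength A B"
proof -
  have "pseudolength (f A) (f B) = pseudolength A B"
    using assms(1)[OF assms(3)] assms(1)[OF assms(4)] assms(2)[OF assms(3,4)] assms(3,4)
    by (simp only: pseudolength_eq_tanh)
  then show ?thesis
    by (simp add: assms pseudolength_def Moebius_function_simple)
qed

lemma Moebius_in_pdisk:
  "A \<in> pdisk \<Longrightarrow> B \<in> pdisk \<Longrightarrow> Moebius_function 0 A B \<in> pdisk"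
  by (simp add: pdisk_iff Moebius_function_norm_lt_1)

lemma hdist_Moebius:
  assumes A: "A \<in> pdisk" and z: "z \<in> pdisk" and w: "w \<in> pdisk"
  shows "hdist (Moebius_function 0 A z) (Moebius_function 0 A w) = hdist z w"
proof -
  define a where "a = 1 - (cmod A)\<^sup>2"
  have a: "a > 0"
    using pdisk_sq[OF A] by (simp add: a_def)
  have one_minus: "1 - (cmod (Moebius_function 0 A v))\<^sup>2
      = a * (1 - (cmod v)\<^sup>2) / (cmod (1 - cnj A * v))\<^sup>2" if "v \<in> pdisk" for v
    using denominator_nz[OF A that] denominator_sq[of A v]
    by (simp add: Moebius_function_simple norm_divide power_divide a_def
        norm_minus_commute field_simps)
  have "Moebius_function 0 A z - Moebius_function 0 A w
      = of_real a * (z - w) / ((1 - cnj A * z) * (1 - cnj A * w))"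
  proof -
    have "of_real a = 1 - A * cnj A"
      by (simp add: a_def complex_norm_square del: of_real_power)
    then show ?thesis
      using denominator_nz[OF A z] denominator_nz[OF A w]
      by (simp add: Moebius_function_simple diff_frac_eq) (simp add: algebra_simps)
  qed
  then have diff: "(cmod (Moebius_function 0 A z - Moebius_function 0 A w))\<^sup>2
      = a\<^sup>2 * (cmod (z - w))\<^sup>2 / ((cmod (1 - cnj A * z))\<^sup>2 * (cmod (1 - cnj A * w))\<^sup>2)"
    by (simp add: norm_divide norm_mult power_divide power_mult_distrib)
  show ?thesis
    unfolding hdist_def diff one_minus[OF z] one_minus[OF w]
    using a denominator_nz[OF A z] denominator_nz[OF A w]
    by (simp add: power2_eq_square)
qed

lemma Moebius_inverse:
  assumes "A \<in> pdisk" "z \<in> pdisk"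
  shows "Moebius_function 0 (-A) (Moebius_function 0 A z) = z"
  using assms by (intro Moebius_function_compose) (auto simp: pdisk_iff)

lemma pseudolength_0: "pseudolength 0 P = cmod P"
  by (simp add: pseudolength_def Moebius_function_simple)

lemma pseudolength_sq:
  "(pseudolength P X)\<^sup>2 = ((cmod X)\<^sup>2 + (cmod P)\<^sup>2 - 2 * (P \<bullet> X)) /
     (1 + (cmod P)\<^sup>2 * (cmod X)\<^sup>2 - 2 * (P \<bullet> X))"
proof -
  have "(cmod (X - P))\<^sup>2 = (cmod X)\<^sup>2 + (cmod P)\<^sup>2 - 2 * (P \<bullet> X)"
    unfolding cmod_power2 by (simp add: inner_complex_def algebra_simps power2_eq_square)
  moreover have "(cmod (1 - cnj P * X))\<^sup>2 = 1 + (cmod P)\<^sup>2 * (cmod X)\<^sup>2 - 2 * (P \<bullet> X)"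
    unfolding cmod_power2 by (simp add: inner_complex_def algebra_simps power2_eq_square)
  ultimately show ?thesis
    by (simp add: pseudolength_def Moebius_function_simple norm_divide power_divide)
qed

lemma pseudolength_sq_eq_iff:
  fixes s :: real
  assumes P: "P \<in> pdisk" and X: "X \<in> pdisk"
    and s: "s = cmod P * cmod X \<or> s = - (cmod P * cmod X)"
  shows "(pseudolength P X)\<^sup>2 = ((cmod X)\<^sup>2 + (cmod P)\<^sup>2 - 2 * s) / (1 - s)\<^sup>2
    \<longleftrightarrow> P \<bullet> X = s"
proof -
  define p where "p = (cmod P)\<^sup>2"
  define x where "x = (cmod X)\<^sup>2"
  define c where "c = P \<bullet> X"
  have px: "p < 1" "x < 1" using P X by (simp_all add: p_def x_def pdisk_sq)
  have ss: "s\<^sup>2 = p * x"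
    using s by (auto simp: p_def x_def power_mult_distrib)
  have "cmod P * cmod X < 1 * 1"
    using P X by (intro mult_strict_mono') (auto simp: pdisk_iff)
  then have "\<bar>s\<bar> < 1" using s by (auto simp: abs_mult)
  then have s1: "(1 - s)\<^sup>2 \<noteq> 0" by simp
  have e: "(1 - s)\<^sup>2 = 1 + p * x - 2 * s"
    using ss by (simp add: power2_eq_square algebra_simps)
  have "1 + p * x - 2 * c = (cmod (1 - cnj P * X))\<^sup>2"
    unfolding cmod_power2 p_def x_def c_def
    by (simp add: inner_complex_def algebra_simps power2_eq_square)
  then have d: "1 + p * x - 2 * c \<noteq> 0"
    using denominator_nz[OF P X] by simp
  have "(x + p - 2 * c) / (1 + p * x - 2 * c) = (x + p - 2 * s) / (1 - s)\<^sup>2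
    \<longleftrightarrow> (x + p - 2 * c) * (1 + p * x - 2 * s) = (x + p - 2 * s) * (1 + p * x - 2 * c)"
    using d s1 unfolding e by (simp add: frac_eq_eq)
  also have "\<dots> \<longleftrightarrow> 2 * ((1 - p) * (1 - x)) * (c - s) = 0"
    by (simp add: algebra_simps) argo
  also have "\<dots> \<longleftrightarrow> c = s" using px by simp
  finally show ?thesis
    unfolding pseudolength_sq p_def x_def c_def .
qed

lemma tanh_hdist_add:
  assumes "A \<in> pdisk" "B \<in> pdisk" "C \<in> pdisk" "D \<in> pdisk"
  shows "tanh ((hdist A B + hdist C D) / 2) =
    (pseudolength A B + pseudolength C D) / (1 + pseudolength A B * pseudolength C D)"
  using assms by (simp add: pseudolength_eq_tanh tanh_add add_divide_distrib)

lemma hbetween_iff: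
  assumes "A \<in> pdisk" "B \<in> pdisk" "C \<in> pdisk"
  shows "hbetween A B C \<longleftrightarrow>
    (pseudolength A B + pseudolength B C) / (1 + pseudolength A B * pseudolength B C) =
      pseudolength A C"
proof -
  have "hbetween A B C \<longleftrightarrow> tanh ((hdist A B + hdist B C) / 2) = tanh (hdist A C / 2)"
    unfolding hbetween_def tanh_real_eq_iff divide_cancel_right by simp
  then show ?thesis
    using tanh_hdist_add[OF assms(1,2,2,3)] pseudolength_eq_tanh[OF assms(1,3)] by simp
qed

lemma hdist_commute: "hdist A B = hdist B A"
  by (simp add: hdist_def norm_minus_commute mult.commute)

lemma pseudolength_commute: "A \<in> pdisk \<Longrightarrow> B \<in> pdisk \<Longrightarrow> pseudolength A B = pseudolength B A"
  by (simp add: pseudolength_eq_tanh hdist_commute)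

lemma zero_in_pdisk: "0 \<in> pdisk"
  by (simp add: pdisk_iff)

lemma hbetween_0_iff:
  assumes P: "P \<in> pdisk" and X: "X \<in> pdisk"
  shows "hbetween 0 P X \<longleftrightarrow> P \<bullet> X = cmod P * cmod X \<and> cmod P \<le> cmod X"
proof -
  define p where "p = cmod P"
  define x where "x = cmod X"
  define d where "d = pseudolength P X"
  have r: "0 \<le> p" "0 \<le> x" "p < 1" "x < 1" "0 \<le> d"
    using P X by (simp_all add: p_def x_def d_def pdisk_iff pseudolength_nonneg)
  have "p * x < 1 * 1" using r by (intro mult_strict_mono') auto
  then have px: "1 - p * x > 0" by simp
  have pd: "1 + p * d > 0" using r by (simp add: add_pos_nonneg)
  have "hbetween 0 P X \<longleftrightarrow> (p + d) / (1 + p * d) = x"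
    using hbetween_iff[OF zero_in_pdisk P X] by (simp add: pseudolength_0 p_def x_def d_def)
  also have "\<dots> \<longleftrightarrow> d = (x - p) / (1 - p * x)"
    using px pd by (auto simp: field_simps)
  also have "\<dots> \<longleftrightarrow> d\<^sup>2 = ((x - p) / (1 - p * x))\<^sup>2 \<and> p \<le> x"
  proof (cases "p \<le> x")
    case True
    then have "(x - p) / (1 - p * x) \<ge> 0" using px by simp
    then show ?thesis using r True by (simp add: power2_eq_iff_nonneg)
  next
    case False
    then have "(x - p) / (1 - p * x) < 0" using px by (simp add: divide_neg_pos)
    then show ?thesis using r False by auto
  qed
  also have "((x - p) / (1 - p * x))\<^sup>2 = (x\<^sup>2 + p\<^sup>2 - 2 * (p * x)) / (1 - p * x)\<^sup>2"
    by (simp add: power_divide power2_diff mult.commute)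
  also have "d\<^sup>2 = \<dots> \<longleftrightarrow> P \<bullet> X = p * x"
    unfolding p_def x_def d_def by (intro pseudolength_sq_eq_iff P X) simp
  finally show ?thesis by (simp add: p_def x_def)
qed

lemma hbetween_mid_0_iff:
  assumes P: "P \<in> pdisk" and X: "X \<in> pdisk"
  shows "hbetween P 0 X \<longleftrightarrow> P \<bullet> X = - (cmod P * cmod X)"
proof -
  define p where "p = cmod P"
  define x where "x = cmod X"
  define d where "d = pseudolength P X"
  have r: "0 \<le> p" "0 \<le> x" "0 \<le> d"
    by (simp_all add: p_def x_def d_def pseudolength_nonneg)
  have "hbetween P 0 X \<longleftrightarrow> d = (p + x) / (1 + p * x)"
    using hbetween_iff[OF P zero_in_pdisk X] pseudolength_commute[OF P zero_in_pdisk]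
    by (auto simp: pseudolength_0 p_def x_def d_def)
  also have "\<dots> \<longleftrightarrow> d\<^sup>2 = ((p + x) / (1 + p * x))\<^sup>2"
    using r by (simp add: power2_eq_iff_nonneg)
  also have "((p + x) / (1 + p * x))\<^sup>2 = (x\<^sup>2 + p\<^sup>2 - 2 * - (p * x)) / (1 - - (p * x))\<^sup>2"
    by (simp add: power_divide power2_sum mult.commute algebra_simps)
  also have "d\<^sup>2 = \<dots> \<longleftrightarrow> P \<bullet> X = - (p * x)"
    unfolding p_def x_def d_def by (intro pseudolength_sq_eq_iff P X) simp
  finally show ?thesis by (simp add: p_def x_def)
qed

lemma homothetic_0_iff:
  assumes P: "P \<in> pdisk" and X: "X \<in> pdisk" and k: "k \<noteq> 0"
  shows "homothetic 0 k P X \<longleftrightarrow> X = k *\<^sub>R P"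
proof -
  have dir: "X \<in> (if k > 0 then hray 0 P else opposite_hray 0 P)
      \<longleftrightarrow> P \<bullet> X = sgn k * (cmod P * cmod X)"
    using P X k hbetween_0_iff[OF P X] hbetween_0_iff[OF X P] hbetween_mid_0_iff[OF P X]
    by (auto simp: hray_def opposite_hray_def inner_commute mult.commute sgn_if)
  have "homothetic 0 k P X \<longleftrightarrow> cmod X = \<bar>k\<bar> * cmod P \<and> P \<bullet> X = sgn k * (cmod P * cmod X)"
    using k unfolding homothetic_def dir pseudolength_0 by simp
  also have "\<dots> \<longleftrightarrow> X = k *\<^sub>R P"
  proof
    assume a: "cmod X = \<bar>k\<bar> * cmod P \<and> P \<bullet> X = sgn k * (cmod P * cmod X)"
    then have c: "P \<bullet> X = k * (cmod P)\<^sup>2"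
      by (simp add: power2_eq_square sgn_if abs_if)
    have "(cmod (X - k *\<^sub>R P))\<^sup>2 = (cmod X)\<^sup>2 + k\<^sup>2 * (cmod P)\<^sup>2 - 2 * k * (P \<bullet> X)"
      unfolding cmod_power2 by (simp add: inner_complex_def algebra_simps power2_eq_square)
    also have "\<dots> = 0"
      using a unfolding c by (simp add: power_mult_distrib power2_eq_square)
    finally show "X = k *\<^sub>R P" by simp
  next
    assume "X = k *\<^sub>R P"
    then show "cmod X = \<bar>k\<bar> * cmod P \<and> P \<bullet> X = sgn k * (cmod P * cmod X)"
      by (simp add: power2_norm_eq_inner[symmetric] power2_eq_square sgn_if abs_if)
  qed
  finally show ?thesis .
qed

lemma homothetic_iff:
  assumes A: "A \<in> pdisk" and P: "P \<in> pdisk" and X: "X \<in> pdisk" and k: "k \<noteq> 0"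
  shows "homothetic A k P X \<longleftrightarrow> Moebius_function 0 A X = k *\<^sub>R Moebius_function 0 A P"
proof -
  let ?M = "Moebius_function 0 A"
  have b: "hbetween (?M u) (?M v) (?M w) \<longleftrightarrow> hbetween u v w"
    if "u \<in> pdisk" "v \<in> pdisk" "w \<in> pdisk" for u v w
    using that A by (simp add: hbetween_def hdist_Moebius)
  have M0: "?M A = 0" by (rule Moebius_function_eq_zero)
  have "homothetic A k P X \<longleftrightarrow> homothetic 0 k (?M P) (?M X)"
    using A P X b[OF A P X] b[OF A X P] b[OF P A X] Moebius_in_pdisk[OF A X]
    unfolding homothetic_def hray_def opposite_hray_def pseudolength_0 M0
    by (simp add: pseudolength_def)
  then show ?thesis
    using homothetic_0_iff[OF Moebius_in_pdisk[OF A P] Moebius_in_pdisk[OF A X] k] by simp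
qed

lemma span_iff:
  assumes "u \<noteq> (0::complex)"
  shows "z \<in> span {u} \<longleftrightarrow> Im (cnj u * z) = 0"
proof
  assume "z \<in> span {u}"
  then obtain t where "z = t *\<^sub>R u" by (auto simp: span_singleton)
  then show "Im (cnj u * z) = 0" by simp
next
  assume "Im (cnj u * z) = 0"
  then have "cnj u * z = of_real (Re (cnj u * z))"
    by (simp add: complex_eq_iff)
  then have "u * cnj u * z = of_real (Re (cnj u * z)) * u"
    by (metis mult.assoc mult.commute)
  then have "of_real ((cmod u)\<^sup>2) * z = of_real (Re (cnj u * z)) * u"
    by (simp only: complex_norm_square)
  then have "z = (Re (cnj u * z) / (cmod u)\<^sup>2) *\<^sub>R u"
    using assms by (simp add: scaleR_conv_of_real field_simps)
  then show "z \<in> span {u}"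
    unfolding span_singleton by blast
qed

lemma is_hline_preimage:
  assumes A: "A \<in> pdisk" and u: "u \<noteq> 0"
  shows "is_hline {z \<in> pdisk. Moebius_function 0 A z \<in> span {u}}"
proof -
  define s where "s = Im (cnj u * A)"
  define w where "w = u - cnj u * A\<^sup>2"
  have A1: "(cmod A)\<^sup>2 < 1" using pdisk_sq[OF A] .
  have "cmod (cnj u * A\<^sup>2) < cmod u"
    using A1 u by (simp add: norm_mult norm_power)
  then have w: "w \<noteq> 0" unfolding w_def by auto
  have wsq: "(cmod w)\<^sup>2 = 4 * s\<^sup>2 + (cmod u)\<^sup>2 * (1 - (cmod A)\<^sup>2)\<^sup>2"
    unfolding cmod_power2 w_def s_def by (simp add: power2_eq_square) algebra
  have key: "Moebius_function 0 A z \<in> span {u} \<longleftrightarrow> Im (cnj w * z) = s * (1 + (cmod z)\<^sup>2)"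
    if z: "z \<in> pdisk" for z
  proof -
    let ?d = "1 - cnj A * z"
    have "Moebius_function 0 A z = (z - A) * cnj ?d / of_real ((cmod ?d)\<^sup>2)"
    proof -
      have "cnj ?d \<noteq> 0"
        using denominator_nz[OF A z] complex_cnj_zero_iff by blast
      then show ?thesis
        unfolding complex_norm_square Moebius_function_simple by simp
    qed
    then have "Im (cnj u * Moebius_function 0 A z) = Im (cnj u * ((z - A) * cnj ?d)) / (cmod ?d)\<^sup>2"
      by (metis Im_divide_of_real times_divide_eq_right)
    moreover have "Im (cnj u * ((z - A) * cnj ?d)) = Im (cnj w * z) - s * (1 + (cmod z)\<^sup>2)"
      unfolding cmod_power2 w_def s_def by (simp add: power2_eq_square) algebra
    ultimately show ?thesis
      using denominator_nz[OF A z] by (simp add: span_iff[OF u])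
  qed
  show ?thesis
  proof (cases "s = 0")
    case True
    then have "{z \<in> pdisk. Moebius_function 0 A z \<in> span {u}} = pdisk \<inter> span {w}"
      using key span_iff[OF w] by auto
    then show ?thesis using w unfolding is_hline_def by blast
  next
    case False
    define c where "c = \<i> * w / of_real (2 * s)"
    define r where "r = sqrt ((cmod c)\<^sup>2 - 1)"
    have csq: "(cmod c)\<^sup>2 = (cmod w)\<^sup>2 / (4 * s\<^sup>2)"
      by (simp add: c_def norm_divide norm_mult power_divide power_mult_distrib)
    have "(cmod w)\<^sup>2 > 4 * s\<^sup>2"
      unfolding wsq using u A1 by simp
    then have c1: "(cmod c)\<^sup>2 > 1"
      using False unfolding csq by simp
    have r: "r > 0" "(cmod c)\<^sup>2 = 1 + r\<^sup>2"
      using c1 by (simp_all add: r_def)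
    have "z \<in> sphere c r \<longleftrightarrow> Im (cnj w * z) = s * (1 + (cmod z)\<^sup>2)" for z
    proof -
      have "z \<in> sphere c r \<longleftrightarrow> (cmod (c - z))\<^sup>2 = r\<^sup>2"
        using r by (simp add: dist_norm power2_eq_iff_nonneg)
      also have "(cmod (c - z))\<^sup>2 = (cmod c)\<^sup>2 + (cmod z)\<^sup>2 - 2 * Re (cnj c * z)"
        unfolding cmod_power2 by (simp add: power2_eq_square algebra_simps)
      also have "Re (cnj c * z) = Im (cnj w * z) / (2 * s)"
        using False by (simp add: c_def field_simps)
      finally show ?thesis
        using False unfolding r by (simp add: field_simps) argo
    qed
    then have "{z \<in> pdisk. Moebius_function 0 A z \<in> span {u}} = pdisk \<inter> sphere c r"
      using key by auto
    then show ?thesis using r unfolding is_hline_def by blast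
  qed
qed

lemma homothetic_imp_hcollinear:
  assumes A: "A \<in> pdisk" and P: "P \<in> pdisk" and h: "homothetic A k P X"
  shows "hcollinear A P X"
proof -
  have k: "k \<noteq> 0" and X: "X \<in> pdisk"
    using h by (auto simp: homothetic_def hray_def opposite_hray_def split: if_splits)
  define v where "v = Moebius_function 0 A P"
  define u where "u = (if v = 0 then 1 else v)"
  have u: "u \<noteq> 0" by (simp add: u_def)
  have v: "v \<in> span {u}" by (simp add: u_def span_base span_zero)
  have "Moebius_function 0 A X = k *\<^sub>R v"
    using h homothetic_iff[OF A P X k] by (simp add: v_def)
  then have "Moebius_function 0 A X \<in> span {u}"
    using v by (simp add: span_scale)
  then show ?thesis
    unfolding hcollinear_def
    using is_hline_preimage[OF A u] A P X v
    by (intro exI[of _ "{z \<in> pdisk. Moebius_function 0 A z \<in> span {u}}"])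
      (auto simp: v_def Moebius_function_eq_zero span_zero)
qed

end

theory Submission
  imports Defs
begin

text \<open>
  In the hyperboloid model, with points taken up to scaling, a hyperbolic circle with center \<open>C\<close>
  and radius \<open>\<rho>\<close> is encoded by the vector \<open>X / sinh \<rho>\<close>, where \<open>X\<close> is the unit time-like vector
  of \<open>C\<close>. Moving the center \<open>P\<close> of a homothety to the origin turns the homothety into a Euclidean
  one, which preserves the quotient of Euclidean center and Euclidean radius up to the sign of the
  ratio. This quotient is the space part of the vector of the circle, so the vectors
  \<open>V\<close>, \<open>V'\<close> of a circle and its image satisfy \<open>V' \<mp> V \<in> span P\<close>. With an even number of
  negative ratios, the three relations add up to a linear dependence between the vectors of
  \<open>P1\<close>, \<open>P2\<close>, \<open>P3\<close>, which is nontrivial because the circles are distinct.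
\<close>

text \<open>The hyperboloid point of \<open>z\<close> is
  \<open>(1 + |z|^2, 2 z) / (1 - |z|^2)\<close>. Only its direction matters here, so the denominator
  is dropped; the space part is halved.\<close>

definition hlift :: "complex \<Rightarrow> real \<times> complex" where
  "hlift z = (1 + (cmod z)\<^sup>2, z)"

text \<open>
  For \<open>t = tanh (\<rho> / 2)\<close> this is \<open>X / sinh \<rho>\<close> up to a constant factor, in coordinates that scale
  the time axis by 2.
\<close>
definition circle_vector :: "complex \<Rightarrow> real \<Rightarrow> real \<times> complex" where
  "circle_vector c t = ((1 - t\<^sup>2) / (t * (1 - (cmod c)\<^sup>2))) *\<^sub>R hlift c"

section \<open>Lines as sections by planes through the origin\<close>

lemma one_plus_norm_sq_pos: "1 + (cmod z)\<^sup>2 > 0"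
  by (simp add: add_pos_nonneg)

text \<open>The equation \<open>s (1 + |z|^2) + w . z = 0\<close> describes a diameter for
  \<open>s = 0\<close> and otherwise a circle with center \<open>- w / (2 s)\<close>, orthogonal to
  the unit circle. The point \<open>P\<close> ensures that the plane meets the model.\<close>

lemma is_hline_hyperplane:
  assumes a: "a \<noteq> 0" and P: "P \<in> pdisk" "a \<bullet> hlift P = 0"
  shows "is_hline {z \<in> pdisk. a \<bullet> hlift z = 0}"
proof -
  obtain s w where sw: "a = (s, w)" by fastforce
  have eq: "a \<bullet> hlift z = s * (1 + (cmod z)\<^sup>2) + w \<bullet> z" for z
    by (simp add: sw hlift_def inner_Pair)
  have w: "w \<noteq> 0"
  proof
    assume "w = 0"
    then have "s = 0" using P(2) one_plus_norm_sq_pos[of P] unfolding eq by simp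
    then show False using a \<open>w = 0\<close> by (simp add: sw zero_prod_def)
  qed
  show ?thesis
  proof (cases "s = 0")
    case True
    have "z \<in> span {\<i> * w} \<longleftrightarrow> w \<bullet> z = 0" for z
      using span_iff[of "\<i> * w" z] w by (simp add: inner_complex_def) argo
    then have "{z \<in> pdisk. a \<bullet> hlift z = 0} = pdisk \<inter> span {\<i> * w}"
      using True unfolding eq by auto
    then show ?thesis using w unfolding is_hline_def by (metis mult_eq_0_iff complex_i_not_zero)
  next
    case False
    define c where "c = (- 1 / (2 * s)) *\<^sub>R w"
    have w_c: "w = (- 2 * s) *\<^sub>R c"
      using False by (simp add: c_def)
    have c: "a \<bullet> hlift z = s * (1 + (cmod z)\<^sup>2 - 2 * (c \<bullet> z))" for z
      unfolding eq w_c by (simp add: algebra_simps)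
    \<comment> \<open>A positive radius needs \<open>|c| > 1\<close>; otherwise Cauchy-Schwarz at
      \<open>P\<close> would give \<open>(1 - |P|)^2 \<le> 0\<close>.\<close>
    have "1 + (cmod P)\<^sup>2 = 2 * (c \<bullet> P)"
      using P(2) False unfolding c by simp
    also have "\<dots> \<le> 2 * (cmod c * cmod P)"
      using norm_cauchy_schwarz[of c P] by simp
    finally have le: "1 + (cmod P)\<^sup>2 \<le> 2 * (cmod c * cmod P)" .
    have "cmod c > 1"
    proof (rule ccontr)
      assume "\<not> cmod c > 1"
      then have "cmod c * cmod P \<le> 1 * cmod P" by (intro mult_right_mono) auto
      then have "(1 - cmod P)\<^sup>2 \<le> 0" using le by (simp add: power2_diff)
      then show False using P(1) by (simp add: pdisk_iff)
    qed
    define r where "r = sqrt ((cmod c)\<^sup>2 - 1)"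
    have r: "r > 0" "(cmod c)\<^sup>2 = 1 + r\<^sup>2"
      using \<open>cmod c > 1\<close> by (simp_all add: r_def)
    have "z \<in> sphere c r \<longleftrightarrow> a \<bullet> hlift z = 0" for z
    proof -
      have "z \<in> sphere c r \<longleftrightarrow> (cmod (c - z))\<^sup>2 = r\<^sup>2"
        using r by (simp add: dist_norm power2_eq_iff_nonneg)
      also have "(cmod (c - z))\<^sup>2 = (cmod c)\<^sup>2 + (cmod z)\<^sup>2 - 2 * (c \<bullet> z)"
        by (simp add: power2_norm_eq_inner inner_diff inner_commute)
      finally show ?thesis using False unfolding c r(2) by auto
    qed
    then have "{z \<in> pdisk. a \<bullet> hlift z = 0} = pdisk \<inter> sphere c r" by blast
    then show ?thesis using r unfolding is_hline_def by blast
  qed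
qed

text \<open>Two vectors always lie on a common plane through the origin of the three-dimensional
  space \<open>real \<times> complex\<close>, even when \<open>B = C\<close>.\<close>

lemma hcollinear_if_hlift_in_span:
  assumes "A \<in> pdisk" "B \<in> pdisk" "C \<in> pdisk"
    and "hlift A \<in> span {hlift B, hlift C}"
  shows "hcollinear A B C"
proof -
  have "dim {hlift B, hlift C} \<le> card {hlift B, hlift C}"
    by (intro dim_le_card') simp
  also have "\<dots> \<le> 2" by (simp add: card_insert_if)
  also have "\<dots> < DIM(real \<times> complex)" by simp
  finally obtain a where a: "a \<noteq> 0" "span {hlift B, hlift C} \<subseteq> {x. a \<bullet> x = 0}"
    using lowdim_subset_hyperplane by blast
  have "a \<bullet> hlift A = 0" "a \<bullet> hlift B = 0" "a \<bullet> hlift C = 0"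
    using subsetD[OF a(2) assms(4)] subsetD[OF a(2) span_base, of "hlift B"]
      subsetD[OF a(2) span_base, of "hlift C"] by simp_all
  then show ?thesis
    unfolding hcollinear_def using is_hline_hyperplane[OF a(1) assms(1)] assms(1-3)
    by (intro exI[of _ "{z \<in> pdisk. a \<bullet> hlift z = 0}"]) simp
qed

section \<open>Circles are determined by their vectors\<close>

lemma hlift_projectively_inj:
  assumes "A \<in> pdisk" "B \<in> pdisk" "\<alpha> > 0" "\<beta> > 0" "\<alpha> *\<^sub>R hlift A = \<beta> *\<^sub>R hlift B"
  shows "A = B" "\<alpha> = \<beta>"
proof -
  define x y where "x = cmod A" and "y = cmod B"
  have xy: "x < 1" "y < 1" "x \<ge> 0" "y \<ge> 0"
    using assms(1,2) by (simp_all add: x_def y_def pdisk_iff)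
  have 1: "\<alpha> * (1 + x\<^sup>2) = \<beta> * (1 + y\<^sup>2)" and 2: "\<alpha> *\<^sub>R A = \<beta> *\<^sub>R B"
    using assms(5) by (simp_all add: hlift_def x_def y_def)
  have 3: "\<alpha> * x = \<beta> * y"
    using arg_cong[OF 2, of cmod] assms(3,4) by (simp add: x_def y_def)
  \<comment> \<open>The factor \<open>1 - x * y\<close> stands for points inverse in the unit
    circle, whose lifts are proportional too; inside the disk it is positive.\<close>
  have "\<beta> * ((x - y) * (1 - x * y)) = 0"
    using 1 3 by algebra
  moreover have "x * y < 1 * 1" using xy by (intro mult_strict_mono') auto
  ultimately have "x = y" using assms(4) by simp
  then show "\<alpha> = \<beta>" using 1 one_plus_norm_sq_pos[of B] by (simp add: y_def)
  then show "A = B" using 2 assms(4) by simp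
qed

lemma circle_vector_weight_pos:
  assumes "c \<in> pdisk" "0 < t" "t < 1"
  shows "(1 - t\<^sup>2) / (t * (1 - (cmod c)\<^sup>2)) > 0"
  using assms pdisk_sq[of c] by (simp add: power_less_one_iff)

lemma circle_vector_fst_pos:
  assumes "c \<in> pdisk" "0 < t" "t < 1"
  shows "fst (circle_vector c t) > 0"
  using mult_pos_pos[OF circle_vector_weight_pos[OF assms] one_plus_norm_sq_pos[of c]]
  by (simp add: circle_vector_def hlift_def)

text \<open>The direction of the vector gives the center; the weight then gives the radius, since
  \<open>(1 - t^2) / t\<close> is injective for \<open>t > 0\<close>.\<close>

lemma circle_vector_inj:
  assumes c: "c \<in> pdisk" "0 < t" "t < 1" and d: "d \<in> pdisk" "0 < s" "s < 1"
    and eq: "circle_vector c t = circle_vector d s"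
  shows "c = d" "t = s"
proof -
  note inj = hlift_projectively_inj[OF c(1) d(1) circle_vector_weight_pos[OF c]
      circle_vector_weight_pos[OF d] eq[unfolded circle_vector_def]]
  show "c = d" by (rule inj)
  have "(1 - t\<^sup>2) * s = (1 - s\<^sup>2) * t"
    using inj(2) pdisk_sq[OF d(1)] c(2) d(2) unfolding \<open>c = d\<close>
    by (simp add: divide_simps split: if_splits)
  then have "(s - t) * (1 + s * t) = 0" by algebra
  moreover have "1 + s * t > 0" using c d by (simp add: add_pos_pos)
  ultimately show "t = s" by simp
qed

section \<open>Hyperbolic circles as Euclidean circles\<close>

lemma is_hcircle_pseudolength:
  assumes "is_hcircle \<omega>"
  obtains c t where "c \<in> pdisk" "0 < t" "t < 1" "\<omega> = {z \<in> pdisk. pseudolength c z = t}"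
proof -
  obtain c r where c: "c \<in> pdisk" "r > 0" "\<omega> = {z \<in> pdisk. hdist c z = r}"
    using assms unfolding is_hcircle_def by blast
  have "hdist c z = r \<longleftrightarrow> pseudolength c z = tanh (r / 2)" if "z \<in> pdisk" for z
    using that c(1) by (simp add: pseudolength_eq_tanh)
  then have "\<omega> = {z \<in> pdisk. pseudolength c z = tanh (r / 2)}" using c(3) by auto
  then show thesis
    using that[of c "tanh (r / 2)"] c(1,2) by (simp add: tanh_real_lt_1)
qed

text \<open>Squaring \<open>|z - c| = t |1 - cnj c z|\<close> and completing the square, with
  leading coefficient \<open>1 - t^2 |c|^2\<close>, yields the Euclidean center and radius.\<close>

lemma hcircle_eq_sphere:
  assumes c: "c \<in> pdisk" and t: "0 < t" "t < 1"
  shows "{z \<in> pdisk. pseudolength c z = t} =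
    sphere (((1 - t\<^sup>2) / (1 - t\<^sup>2 * (cmod c)\<^sup>2)) *\<^sub>R c)
      (t * (1 - (cmod c)\<^sup>2) / (1 - t\<^sup>2 * (cmod c)\<^sup>2))"
    (is "_ = sphere ?e ?r")
proof -
  define C where "C = (cmod c)\<^sup>2"
  define a where "a = 1 - t\<^sup>2 * C"
  have C: "0 \<le> C" "C < 1" using pdisk_sq[OF c] by (simp_all add: C_def)
  have t2: "0 < t\<^sup>2" "t\<^sup>2 < 1" using t by (simp_all add: power_less_one_iff)
  have "t\<^sup>2 * C < 1 * 1" using C t2 by (intro mult_strict_mono') auto
  then have a: "a > 0" by (simp add: a_def)
  have D: "(cmod (1 - cnj c * z))\<^sup>2 = (cmod (z - c))\<^sup>2 + (1 - C) * (1 - (cmod z)\<^sup>2)" for z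
    using denominator_sq[of c z] by (simp add: C_def norm_minus_commute)
  have N: "(cmod (z - c))\<^sup>2 = (cmod z)\<^sup>2 + C - 2 * (c \<bullet> z)" for z
    by (simp add: C_def power2_norm_eq_inner inner_diff inner_commute)
  \<comment> \<open>The squared equation alone keeps \<open>z\<close> in the disk: outside,
    \<open>|1 - cnj c z| \<le> |z - c|\<close>, which contradicts \<open>t < 1\<close>.\<close>
  have disk: "z \<in> pdisk" if "(cmod (z - c))\<^sup>2 = t\<^sup>2 * (cmod (1 - cnj c * z))\<^sup>2" for z
  proof (rule ccontr)
    assume "z \<notin> pdisk"
    then have z: "1 \<le> (cmod z)\<^sup>2" by (simp add: pdisk_iff)
    then have "z \<noteq> c" using C by (auto simp: C_def)
    then have pos: "(cmod (z - c))\<^sup>2 > 0" by simp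
    have "(1 - C) * (1 - (cmod z)\<^sup>2) \<le> 0"
      using C z by (simp add: mult_nonneg_nonpos)
    then have "(cmod (1 - cnj c * z))\<^sup>2 \<le> (cmod (z - c))\<^sup>2" unfolding D by simp
    then have "t\<^sup>2 * (cmod (1 - cnj c * z))\<^sup>2 \<le> t\<^sup>2 * (cmod (z - c))\<^sup>2"
      using t2 by simp
    also have "\<dots> < 1 * (cmod (z - c))\<^sup>2"
      using t2 pos by (intro mult_strict_right_mono)
    finally show False using that by simp
  qed
  have sph: "z \<in> sphere ?e ?r \<longleftrightarrow> (cmod (z - c))\<^sup>2 = t\<^sup>2 * (cmod (1 - cnj c * z))\<^sup>2" for z
  proof -
    have "?r \<ge> 0" using a C t by (simp add: a_def C_def)
    then have "z \<in> sphere ?e ?r \<longleftrightarrow> (cmod (?e - z))\<^sup>2 = ?r\<^sup>2"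
      by (simp add: dist_norm power2_eq_iff_nonneg)
    also have "\<dots> \<longleftrightarrow> a\<^sup>2 * (cmod (?e - z))\<^sup>2 = a\<^sup>2 * ?r\<^sup>2"
      using a by simp
    also have "a\<^sup>2 * ?r\<^sup>2 = t\<^sup>2 * (1 - C)\<^sup>2"
      using a by (simp add: a_def C_def power_divide power_mult_distrib)
    also have "a\<^sup>2 * (cmod (?e - z))\<^sup>2 = (cmod (a *\<^sub>R (?e - z)))\<^sup>2"
      by (simp add: power_mult_distrib)
    also have "a *\<^sub>R (?e - z) = (1 - t\<^sup>2) *\<^sub>R c - a *\<^sub>R z"
      using a by (simp add: scaleR_diff_right a_def C_def)
    also have "(cmod \<dots>)\<^sup>2 = (1 - t\<^sup>2)\<^sup>2 * C + a\<^sup>2 * (cmod z)\<^sup>2 - 2 * (1 - t\<^sup>2) * a * (c \<bullet> z)"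
      unfolding C_def power2_norm_eq_inner inner_diff inner_scaleR_left inner_scaleR_right
      by (simp add: inner_commute power2_eq_square) (simp add: algebra_simps)
    also have "\<dots> = t\<^sup>2 * (1 - C)\<^sup>2 \<longleftrightarrow>
        a * ((cmod (z - c))\<^sup>2 - t\<^sup>2 * (cmod (1 - cnj c * z))\<^sup>2) = 0"
      unfolding D N a_def by (simp add: power2_eq_square algebra_simps)
    finally show ?thesis using a by simp
  qed
  have "pseudolength c z = t \<longleftrightarrow> (cmod (z - c))\<^sup>2 = t\<^sup>2 * (cmod (1 - cnj c * z))\<^sup>2"
    if "z \<in> pdisk" for z
  proof -
    have "pseudolength c z = t \<longleftrightarrow> cmod (z - c) = t * cmod (1 - cnj c * z)"
      using denominator_nz[OF c that]
      by (simp add: pseudolength_def Moebius_function_simple norm_divide field_simps)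
    also have "\<dots> \<longleftrightarrow> (cmod (z - c))\<^sup>2 = (t * cmod (1 - cnj c * z))\<^sup>2"
      using t by (simp add: power2_eq_iff_nonneg)
    finally show ?thesis by (simp add: power_mult_distrib)
  qed
  then show ?thesis using disk sph by blast
qed

text \<open>The line through both centers meets the first circle at signed distances
  \<open>|v| + r\<close> and \<open>|v| - r\<close> from \<open>d\<close>; both have absolute value
  \<open>s\<close> only if \<open>v = 0\<close>.\<close>

lemma sphere_eq_sphere_complex:
  fixes c d :: complex
  assumes r: "r > 0" and eq: "sphere c r = sphere d s"
  shows "c = d" "r = s"
proof -
  define v where "v = c - d"
  \<comment> \<open>Equal centers give no direction, so an arbitrary unit vector serves.\<close>
  define u where "u = (if v = 0 then 1 else sgn v)"
  have u: "cmod u = 1" "v = cmod v *\<^sub>R u"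
    by (simp_all add: u_def norm_sgn sgn_div_norm)
  have x: "\<bar>cmod v + x\<bar> = s" if "\<bar>x\<bar> = r" for x
  proof -
    have "c + x *\<^sub>R u \<in> sphere d s"
      unfolding eq[symmetric] using that u(1) by (simp add: dist_norm)
    then have "cmod (c + x *\<^sub>R u - d) = s"
      by (simp add: dist_commute flip: dist_norm)
    moreover have "c + x *\<^sub>R u - d = (cmod v + x) *\<^sub>R u"
      using u(2) by (simp add: v_def algebra_simps)
    ultimately show ?thesis using u(1) by simp
  qed
  have "cmod v + r = s" "\<bar>cmod v - r\<bar> = s"
    using x[of r] x[of "- r"] r by auto
  then have "cmod v = 0" using r by (auto simp: abs_if split: if_splits)
  then show "c = d" "r = s" using \<open>cmod v + r = s\<close> by (simp_all add: v_def)
qed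

section \<open>Homotheties acting on circles\<close>

lemma Moebius_image_hcircle:
  assumes A: "A \<in> pdisk" and c: "c \<in> pdisk"
  shows "Moebius_function 0 A ` {z \<in> pdisk. pseudolength c z = t} =
    {z \<in> pdisk. pseudolength (Moebius_function 0 A c) z = t}"
proof -
  have inv: "Moebius_function 0 A (Moebius_function 0 (- A) z) = z" if "z \<in> pdisk" for z
    using Moebius_inverse[of "- A" z] A that by (simp add: pdisk_iff)
  have "pseudolength (Moebius_function 0 A c) (Moebius_function 0 A z) = pseudolength c z"
    if "z \<in> pdisk" for z
    using hdist_eq_iff Moebius_in_pdisk[OF A] hdist_Moebius[OF A] c that by blast
  moreover have "Moebius_function 0 (- A) z \<in> pdisk" if "z \<in> pdisk" for z
    using A that by (intro Moebius_in_pdisk) (simp_all add: pdisk_iff)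
  ultimately show ?thesis using Moebius_in_pdisk[OF A] inv by (auto simp: image_iff) metis
qed

lemma homothety_takes_image:
  assumes "homothety_takes A k S T" "S \<subseteq> pdisk"
  shows "Moebius_function 0 A ` T = (\<lambda>w. k *\<^sub>R w) ` Moebius_function 0 A ` S"
proof -
  have A: "A \<in> pdisk" and k: "k \<noteq> 0" and small: "\<And>P. P \<in> S \<Longrightarrow> \<bar>k\<bar> * pseudolength A P < 1"
    and T: "T = {X. \<exists>P\<in>S. homothetic A k P X}"
    using assms unfolding homothety_takes_def by auto
  have T': "X \<in> T \<longleftrightarrow>
      X \<in> pdisk \<and> (\<exists>P\<in>S. Moebius_function 0 A X = k *\<^sub>R Moebius_function 0 A P)" for X
  proof -
    have "X \<in> pdisk" if "homothetic A k P X" for P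
      using that by (auto simp: homothetic_def hray_def opposite_hray_def split: if_splits)
    then show ?thesis unfolding T using homothetic_iff[OF A _ _ k] assms(2) by blast
  qed
  show ?thesis
  proof (intro equalityI subsetI)
    fix w assume "w \<in> Moebius_function 0 A ` T"
    then show "w \<in> (\<lambda>w. k *\<^sub>R w) ` Moebius_function 0 A ` S"
      unfolding image_iff T' Bex_def by blast
  next
    fix w assume "w \<in> (\<lambda>w. k *\<^sub>R w) ` Moebius_function 0 A ` S"
    then obtain P where P: "P \<in> S" "w = k *\<^sub>R Moebius_function 0 A P" by blast
    \<comment> \<open>Definedness of the homothety at \<open>P\<close> keeps the scaled point in the
      disk, so the inverse motion supplies a preimage.\<close>
    have w: "w \<in> pdisk"
      using small[OF P(1)] by (simp add: P(2) pdisk_iff pseudolength_def)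
    define X where "X = Moebius_function 0 (- A) w"
    have mA: "- A \<in> pdisk" using A by (simp add: pdisk_iff)
    have "X \<in> pdisk" "Moebius_function 0 A X = w"
      using Moebius_in_pdisk[OF mA w] Moebius_inverse[OF mA w] by (simp_all add: X_def)
    then show "w \<in> Moebius_function 0 A ` T"
      using P T' by (intro image_eqI[of _ _ X]) auto
  qed
qed

text \<open>This is half the space part of the hyperboloid point of \<open>c\<close> after the
  motion taking \<open>A\<close> to 0. The numerator on the right is real-linear in
  \<open>hlift c\<close>: motions act linearly on the hyperboloid model.\<close>

lemma Moebius_function_weighted:
  assumes A: "A \<in> pdisk" and c: "c \<in> pdisk"
  defines "w \<equiv> Moebius_function 0 A c"
  shows "w /\<^sub>R (1 - (cmod w)\<^sup>2) =
    (c + A\<^sup>2 * cnj c - (1 + (cmod c)\<^sup>2) *\<^sub>R A) /\<^sub>R ((1 - (cmod A)\<^sup>2) * (1 - (cmod c)\<^sup>2))"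
proof -
  let ?d = "1 - cnj A * c"
  have d: "?d \<noteq> 0" by (rule denominator_nz[OF A c])
  have "1 - (cmod w)\<^sup>2 = (1 - (cmod A)\<^sup>2) * (1 - (cmod c)\<^sup>2) / (cmod ?d)\<^sup>2"
    using d denominator_sq[of A c]
    by (simp add: w_def Moebius_function_simple norm_divide power_divide norm_minus_commute
        field_simps)
  then have "w /\<^sub>R (1 - (cmod w)\<^sup>2) =
      (of_real ((cmod ?d)\<^sup>2) * w) /\<^sub>R ((1 - (cmod A)\<^sup>2) * (1 - (cmod c)\<^sup>2))"
    by (simp add: scaleR_conv_of_real divide_inverse mult_ac)
  also have "of_real ((cmod ?d)\<^sup>2) * w = (c - A) * cnj ?d"
    using d unfolding complex_norm_square by (simp add: w_def Moebius_function_simple)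
  also have "\<dots> = c + A\<^sup>2 * cnj c - (1 + of_real ((cmod c)\<^sup>2)) * A"
    unfolding complex_norm_square by (simp add: power2_eq_square algebra_simps)
  finally show ?thesis by (simp add: scaleR_conv_of_real)
qed

text \<open>The equation says that the vector \<open>(n, m)\<close>, moved by the motion taking \<open>A\<close> to 0, has no space part.\<close>
lemma hlift_kernel:
  assumes A: "A \<in> pdisk" and eq: "m + A\<^sup>2 * cnj m = n *\<^sub>R A"
  shows "(n, m) \<in> span {hlift A}"
proof -
  \<comment> \<open>This \<open>l\<close> matches the time components. The remaining space part
    \<open>v\<close> satisfies \<open>|v| = |A|^2 |v|\<close>, hence vanishes.\<close>
  define l where "l = n / (1 + (cmod A)\<^sup>2)"
  define v where "v = m - l *\<^sub>R A"
  have n: "n = l * (1 + (cmod A)\<^sup>2)"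
    using one_plus_norm_sq_pos[of A] by (simp add: l_def)
  have "of_real n = of_real l * (1 + A * cnj A)"
    unfolding n using complex_norm_square[of A] by simp
  then have "v = - (A\<^sup>2 * cnj v)"
    using eq by (simp add: v_def scaleR_conv_of_real power2_eq_square algebra_simps)
  then have "cmod v = (cmod A)\<^sup>2 * cmod v"
    by (metis complex_mod_cnj norm_minus_cancel norm_mult norm_power)
  then have "v = 0" using pdisk_sq[OF A] by simp
  then have "(n, m) = l *\<^sub>R hlift A" by (simp add: hlift_def v_def n)
  then show ?thesis by (simp add: span_base span_scale)
qed

lemma homothety_circle_vector:
  assumes c: "c \<in> pdisk" "0 < t" "t < 1" and d: "d \<in> pdisk" "0 < s" "s < 1"
    and h: "homothety_takes A k {z \<in> pdisk. pseudolength c z = t} {z \<in> pdisk. pseudolength d z = s}"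
  shows "circle_vector d s - sgn k *\<^sub>R circle_vector c t \<in> span {hlift A}"
proof -
  have A: "A \<in> pdisk" and k: "k \<noteq> 0"
    using h unfolding homothety_takes_def by auto
  \<comment> \<open>\<open>e\<close> and \<open>r\<close> are the Euclidean center and radius of the
    circle with hyperbolic center \<open>w\<close>; \<open>W c\<close> is the numerator of the moved
    space part of \<open>c\<close>.\<close>
  define e r where "e = (\<lambda>w t. ((1 - t\<^sup>2) / (1 - t\<^sup>2 * (cmod w)\<^sup>2)) *\<^sub>R w)"
    and "r = (\<lambda>w t. t * (1 - (cmod w)\<^sup>2) / (1 - t\<^sup>2 * (cmod w)\<^sup>2))"
  define W where "W = (\<lambda>c. c + A\<^sup>2 * cnj c - (1 + (cmod c)\<^sup>2) *\<^sub>R A)"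
  have pos: "1 - t\<^sup>2 * (cmod w)\<^sup>2 > 0" if "w \<in> pdisk" "0 < t" "t < 1" for w t
  proof -
    have "t\<^sup>2 * (cmod w)\<^sup>2 < 1 * 1"
      using that pdisk_sq by (intro mult_strict_mono') (auto simp: power_less_one_iff)
    then show ?thesis by simp
  qed
  have r_pos: "r w t > 0" if "w \<in> pdisk" "0 < t" "t < 1" for w t
    using pos[OF that] that pdisk_sq[of w] by (simp add: r_def)
  let ?M = "Moebius_function 0 A"
  have Mc: "?M c \<in> pdisk" and Md: "?M d \<in> pdisk"
    using A c d by (simp_all add: Moebius_in_pdisk)
  have sph: "{z \<in> pdisk. pseudolength (?M c) z = t} = sphere (e (?M c) t) (r (?M c) t)"
    if "c \<in> pdisk" "0 < t" "t < 1" for c t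
    using hcircle_eq_sphere[OF Moebius_in_pdisk[OF A that(1)] that(2,3)] by (simp add: e_def r_def)
  have "sphere (e (?M d) s) (r (?M d) s) = (\<lambda>w. k *\<^sub>R w) ` sphere (e (?M c) t) (r (?M c) t)"
    using homothety_takes_image[OF h]
    unfolding Moebius_image_hcircle[OF A c(1)] Moebius_image_hcircle[OF A d(1)] sph[OF c] sph[OF d]
    by auto
  also have "\<dots> = sphere (k *\<^sub>R e (?M c) t) (\<bar>k\<bar> * r (?M c) t)"
    using k by (rule sphere_scale)
  finally have ed: "e (?M d) s = k *\<^sub>R e (?M c) t" and rd: "r (?M d) s = \<bar>k\<bar> * r (?M c) t"
    using sphere_eq_sphere_complex r_pos[OF Md d(2,3)] by blast+
  \<comment> \<open>The denominators of center and radius cancel in the quotient, leaving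
    \<open>(1 - t^2) / t\<close> times \<open>w / (1 - |w|^2)\<close> for the moved center
    \<open>w\<close>.\<close>
  have er: "e (?M c) t /\<^sub>R r (?M c) t =
      ((1 - t\<^sup>2) / (t * (1 - (cmod c)\<^sup>2))) *\<^sub>R W c /\<^sub>R (1 - (cmod A)\<^sup>2)"
    if "c \<in> pdisk" "0 < t" "t < 1" for c t
  proof -
    define C where "C = (cmod (?M c))\<^sup>2"
    define D where "D = 1 - t\<^sup>2 * C"
    have "D > 0"
      using pos[OF Moebius_in_pdisk[OF A that(1)] that(2,3)] by (simp add: C_def D_def)
    then have "(1 - t\<^sup>2) / D * inverse (t * (1 - C) / D) = (1 - t\<^sup>2) / t * inverse (1 - C)"
      by (simp add: divide_inverse)
    then have "e (?M c) t /\<^sub>R r (?M c) t = ((1 - t\<^sup>2) / t) *\<^sub>R (?M c /\<^sub>R (1 - (cmod (?M c))\<^sup>2))"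
      unfolding e_def r_def C_def[symmetric] D_def[symmetric] scaleR_scaleR
      by (simp only: mult.commute)
    then show ?thesis
      unfolding Moebius_function_weighted[OF A that(1)] W_def by (simp add: field_simps)
  qed
  define \<alpha> \<beta> where "\<alpha> = (1 - s\<^sup>2) / (s * (1 - (cmod d)\<^sup>2))"
    and "\<beta> = sgn k * ((1 - t\<^sup>2) / (t * (1 - (cmod c)\<^sup>2)))"
  \<comment> \<open>The center is multiplied by \<open>k\<close> and the radius by
    \<open>|k|\<close>, so only the sign of the ratio survives in the quotient.\<close>
  have "e (?M d) s /\<^sub>R r (?M d) s = sgn k *\<^sub>R (e (?M c) t /\<^sub>R r (?M c) t)"
    unfolding ed rd using k by (simp add: sgn_if)
  then have "inverse (1 - (cmod A)\<^sup>2) *\<^sub>R (\<alpha> *\<^sub>R W d) = inverse (1 - (cmod A)\<^sup>2) *\<^sub>R (\<beta> *\<^sub>R W c)"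
    unfolding er[OF c] er[OF d] \<alpha>_def \<beta>_def by (metis scaleR_left_commute scaleR_scaleR)
  then have W: "\<alpha> *\<^sub>R W d = \<beta> *\<^sub>R W c"
    unfolding scaleR_cancel_left using pdisk_sq[OF A] by simp
  \<comment> \<open>By linearity, the weighted relation for \<open>W\<close> becomes the kernel
    equation of \<open>hlift_kernel\<close> for the difference of the two vectors.\<close>
  have "(\<alpha> *\<^sub>R d - \<beta> *\<^sub>R c) + A\<^sup>2 * cnj (\<alpha> *\<^sub>R d - \<beta> *\<^sub>R c) =
      (\<alpha> * (1 + (cmod d)\<^sup>2) - \<beta> * (1 + (cmod c)\<^sup>2)) *\<^sub>R A"
  proof -
    have "(\<alpha> *\<^sub>R d - \<beta> *\<^sub>R c) + A\<^sup>2 * cnj (\<alpha> *\<^sub>R d - \<beta> *\<^sub>R c) -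
        (\<alpha> * (1 + (cmod d)\<^sup>2) - \<beta> * (1 + (cmod c)\<^sup>2)) *\<^sub>R A = \<alpha> *\<^sub>R W d - \<beta> *\<^sub>R W c"
      unfolding W_def by (simp add: algebra_simps)
    then show ?thesis unfolding W by simp
  qed
  from hlift_kernel[OF A this] show ?thesis
    by (simp add: circle_vector_def hlift_def \<alpha>_def \<beta>_def mult.assoc)
qed

section \<open>Linear dependence of the three centers\<close>

theorem theorem9:
  fixes \<omega>1 \<omega>2 \<omega>3 :: "complex set"
    and P1 P2 P3 :: complex
    and k1 k2 k3 :: real
  assumes "is_hcircle \<omega>1" and "is_hcircle \<omega>2" and "is_hcircle \<omega>3"
    and "\<omega>1 \<noteq> \<omega>2" and "\<omega>1 \<noteq> \<omega>3" and "\<omega>2 \<noteq> \<omega>3"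
    and "homothety_takes P1 k1 \<omega>2 \<omega>3"
    and "homothety_takes P2 k2 \<omega>1 \<omega>3"
    and "homothety_takes P3 k3 \<omega>1 \<omega>2"
    and "(k1 > 0 \<and> k2 > 0 \<and> k3 > 0) \<or>
         (k1 > 0 \<and> k2 < 0 \<and> k3 < 0) \<or>
         (k1 < 0 \<and> k2 > 0 \<and> k3 < 0) \<or>
         (k1 < 0 \<and> k2 < 0 \<and> k3 > 0)"
  shows "hcollinear P1 P2 P3"
proof -
  obtain c1 t1 where 1: "c1 \<in> pdisk" "0 < t1" "t1 < 1" "\<omega>1 = {z \<in> pdisk. pseudolength c1 z = t1}"
    using is_hcircle_pseudolength[OF assms(1)] .
  obtain c2 t2 where 2: "c2 \<in> pdisk" "0 < t2" "t2 < 1" "\<omega>2 = {z \<in> pdisk. pseudolength c2 z = t2}"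
    using is_hcircle_pseudolength[OF assms(2)] .
  obtain c3 t3 where 3: "c3 \<in> pdisk" "0 < t3" "t3 < 1" "\<omega>3 = {z \<in> pdisk. pseudolength c3 z = t3}"
    using is_hcircle_pseudolength[OF assms(3)] .
  have P: "P1 \<in> pdisk" "P2 \<in> pdisk" "P3 \<in> pdisk"
    using assms(7-9) unfolding homothety_takes_def by auto
  define V1 V2 V3 where "V1 = circle_vector c1 t1" and "V2 = circle_vector c2 t2"
    and "V3 = circle_vector c3 t3"
  have h1: "V3 - sgn k1 *\<^sub>R V2 \<in> span {hlift P1}"
    and h2: "V3 - sgn k2 *\<^sub>R V1 \<in> span {hlift P2}"
    and h3: "V2 - sgn k3 *\<^sub>R V1 \<in> span {hlift P3}"
    using homothety_circle_vector[OF 2(1-3) 3(1-3)] homothety_circle_vector[OF 1(1-3) 3(1-3)]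
      homothety_circle_vector[OF 1(1-3) 2(1-3)] assms(7-9)
    unfolding 1(4) 2(4) 3(4) V1_def V2_def V3_def by blast+
  obtain l where l: "V3 - sgn k1 *\<^sub>R V2 = l *\<^sub>R hlift P1"
    using h1 by (auto simp: span_singleton)
  \<comment> \<open>Otherwise \<open>V3\<close> is \<open>V2\<close> up to sign; positive time
    components exclude the minus sign, and equal vectors mean equal circles.\<close>
  have "l \<noteq> 0"
  proof
    assume "l = 0"
    then have eq: "V3 = sgn k1 *\<^sub>R V2" using l by simp
    have "fst V3 > 0" "fst V2 > 0"
      using 2 3 circle_vector_fst_pos by (simp_all add: V2_def V3_def)
    then have "sgn k1 = 1"
      using arg_cong[OF eq, of fst] by (simp add: sgn_if split: if_splits)
    then have "circle_vector c3 t3 = circle_vector c2 t2"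
      using eq by (simp add: V2_def V3_def)
    then show False
      using circle_vector_inj[OF 3(1-3) 2(1-3)] assms(6) 2(4) 3(4) by simp
  qed
  \<comment> \<open>The terms in \<open>V1\<close> cancel because
    \<open>sgn k2 = sgn k1 * sgn k3\<close> in each of the four sign patterns.\<close>
  have "V3 - sgn k1 *\<^sub>R V2 =
      (V3 - sgn k2 *\<^sub>R V1) - sgn k1 *\<^sub>R (V2 - sgn k3 *\<^sub>R V1)"
    using assms(10) by (auto simp: algebra_simps)
  also have "\<dots> \<in> span {hlift P2, hlift P3}"
  proof (rule span_diff[OF _ span_scale])
    show "V3 - sgn k2 *\<^sub>R V1 \<in> span {hlift P2, hlift P3}"
      using h2 span_mono[of "{hlift P2}" "{hlift P2, hlift P3}"] by blast
    show "V2 - sgn k3 *\<^sub>R V1 \<in> span {hlift P2, hlift P3}"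
      using h3 span_mono[of "{hlift P3}" "{hlift P2, hlift P3}"] by blast
  qed
  finally have "hlift P1 \<in> span {hlift P2, hlift P3}"
    unfolding l using span_scale[of "l *\<^sub>R hlift P1" _ "1 / l"] \<open>l \<noteq> 0\<close> by simp
  then show ?thesis using hcollinear_if_hlift_in_span P by blast
qed

end
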